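(* Let $S$ be a nonempty subset of $\{A,B,C,D\}$. Suppose $P$ is a finite poset such that $val(\mathcal C)\le 0$ for every forcing cycle $\mathcal C$ in $P$, and such that for every forcing cycle $\mathcal C$ in $P$ with $val(\mathcal C)=0$, the subposet of $P$ induced by the elements of $\mathcal C$ is an $S$-order. Then $P$ is an $S$-order.
   Context: Interval types: every interval $I_v$ has left endpoint $L(v)$, right endpoint $R(v)$, center $c(v)=(L(v)+R(v))/2$, and one of four types: $A$ (endpoints closed, center closed), $B$ (endpoints open, center open), $C$ (endpoints closed, center open), $D$ (endpoints open, center closed); the center always belongs to the interval. For nonempty $S\subseteq\{A,B,C,D\}$, an $S$-representation of a poset $(X,\prec)$ assigns to each $x\in X$ an interval $I_x$, all of the same positive length, each of type in $S$, such that $x\prec y$ iff (i) $R(x)<c(y)$, or (ii) $R(x)=c(y)$, at least one of $R(x),c(y)$ is open, and at least one of $L(y),c(x)$ is open. An $S$-order is a poset with an $S$-representation. For distinct elements, $x\parallel y$ means incomparable. A forcing cycle is a sequence $x_0,x_1,\dots,x_t$ with $t\ge1$, $x_t=x_0$, and for each $0\le i\le t-1$ either $x_i\prec x_{i+1}$ or $x_i\parallel x_{i+1}$; its value $val(\mathcal C)$ is the number of indices $i$ with $x_i\prec x_{i+1}$ minus the number of indices $i$ with $x_i\parallel x_{i+1}$. *)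

theory Defs
  imports Complex_Main
begin

datatype interval_type = Type_A | Type_B | Type_C | Type_D

fun endpoints_open :: "interval_type \<Rightarrow> bool" where
  "endpoints_open Type_A \<longleftrightarrow> False"
| "endpoints_open Type_B \<longleftrightarrow> True"
| "endpoints_open Type_C \<longleftrightarrow> False"
| "endpoints_open Type_D \<longleftrightarrow> True"

fun center_open :: "interval_type \<Rightarrow> bool" where
  "center_open Type_A \<longleftrightarrow> False"
| "center_open Type_B \<longleftrightarrow> True"
| "center_open Type_C \<longleftrightarrow> True"
| "center_open Type_D \<longleftrightarrow> False"

text \<open>An open center is only a label on the interval: the center point still belongs to the
  interval, so the endpoints together with the type determine all the data.\<close>

datatype typed_interval =
  Interval (left_end: real) (right_end: real) (itype: interval_type)

definition center :: "typed_interval \<Rightarrow> real" where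
  "center I = (left_end I + right_end I) / 2"

definition interval_precedes :: "typed_interval \<Rightarrow> typed_interval \<Rightarrow> bool" where
  "interval_precedes I J \<longleftrightarrow>
     right_end I < center J \<or>
     right_end I = center J \<and>
       (endpoints_open (itype I) \<or> center_open (itype J)) \<and>
       (endpoints_open (itype J) \<or> center_open (itype I))"

definition strict_poset :: "'a set \<Rightarrow> ('a \<Rightarrow> 'a \<Rightarrow> bool) \<Rightarrow> bool" where
  "strict_poset X r \<longleftrightarrow> irreflp_on X r \<and> transp_on X r"

definition S_representation ::
  "interval_type set \<Rightarrow> 'a set \<Rightarrow> ('a \<Rightarrow> 'a \<Rightarrow> bool) \<Rightarrow> ('a \<Rightarrow> typed_interval) \<Rightarrow> bool" where
  "S_representation S X r I \<longleftrightarrow>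
     (\<exists>len>0. \<forall>x\<in>X. right_end (I x) - left_end (I x) = len) \<and>
     (\<forall>x\<in>X. itype (I x) \<in> S) \<and>
     (\<forall>x\<in>X. \<forall>y\<in>X. r x y \<longleftrightarrow> interval_precedes (I x) (I y))"

definition S_order :: "interval_type set \<Rightarrow> 'a set \<Rightarrow> ('a \<Rightarrow> 'a \<Rightarrow> bool) \<Rightarrow> bool" where
  "S_order S X r \<longleftrightarrow> strict_poset X r \<and> (\<exists>I. S_representation S X r I)"

definition incomparable :: "('a \<Rightarrow> 'a \<Rightarrow> bool) \<Rightarrow> 'a \<Rightarrow> 'a \<Rightarrow> bool" where
  "incomparable r x y \<longleftrightarrow> x \<noteq> y \<and> \<not> r x y \<and> \<not> r y x"

text \<open>A sequence \<open>x\<^sub>0, \<dots>, x\<^sub>t\<close> is given by a function on \<open>nat\<close> together with \<open>t\<close>; its values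
  beyond \<open>t\<close> are irrelevant.\<close>

definition forcing_cycle ::
  "'a set \<Rightarrow> ('a \<Rightarrow> 'a \<Rightarrow> bool) \<Rightarrow> (nat \<Rightarrow> 'a) \<Rightarrow> nat \<Rightarrow> bool" where
  "forcing_cycle X r x t \<longleftrightarrow>
     t \<ge> 1 \<and> x t = x 0 \<and> (\<forall>i\<le>t. x i \<in> X) \<and>
     (\<forall>i<t. r (x i) (x (Suc i)) \<or> incomparable r (x i) (x (Suc i)))"

definition cycle_val :: "('a \<Rightarrow> 'a \<Rightarrow> bool) \<Rightarrow> (nat \<Rightarrow> 'a) \<Rightarrow> nat \<Rightarrow> int" where
  "cycle_val r x t =
     int (card {i. i < t \<and> r (x i) (x (Suc i))}) -
     int (card {i. i < t \<and> incomparable r (x i) (x (Suc i))})"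

end

theory Submission
  imports Defs
begin

text \<open>
  Give a step \<open>x \<prec> y\<close> weight \<open>1\<close> and a step \<open>x \<parallel> y\<close> weight \<open>-1\<close>. In a representation with
  half-length \<open>1\<close>, centers satisfy \<open>c x + w x y \<le> c y\<close> for every step, and types matter only for
  steps where equality holds; equality is forced exactly for the tight steps, those lying on a
  forcing cycle of value \<open>0\<close>. Raise the weight of every other step by a small \<open>\<epsilon>\<close>. Since values are
  integers and a simple cycle has at most \<open>card X\<close> steps, no simple cycle becomes positive, so the
  maximal weight of a simple path ending at \<open>x\<close> is a potential, which serves as \<open>c x\<close>. All value-\<open>0\<close>
  cycles through a point merge into one cycle; a representation of its elements supplies the
  types, and these are right for tight steps because there that representation has equality too.
\<close>

section \<open>Weights of walks and potentials from heaviest paths\<close>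

text \<open>Kept polymorphic in the weights so that integer cycle values and their real
  perturbations share the same lemmas.\<close>

fun walk_weight :: "('a \<Rightarrow> 'a \<Rightarrow> 'b::comm_monoid_add) \<Rightarrow> 'a list \<Rightarrow> 'b" where
  "walk_weight w (x # y # zs) = w x y + walk_weight w (y # zs)"
| "walk_weight w _ = 0"

lemma walk_weight_append:
  "walk_weight w (xs @ y # zs) = walk_weight w (xs @ [y]) + walk_weight w (y # zs)"
  by (induction w xs rule: walk_weight.induct) (auto simp: ac_simps)

lemma walk_weight_add:
  "walk_weight (\<lambda>x y. w x y + e x y) xs = walk_weight w xs + walk_weight e xs"
  by (induction w xs rule: walk_weight.induct) (auto simp: ac_simps)

lemma walk_weight_of_int:
  "walk_weight (\<lambda>x y. of_int (w x y)) xs = (of_int (walk_weight w xs) :: 'b::ring_1)"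
  by (induction w xs rule: walk_weight.induct) auto

lemma walk_weight_le:
  fixes e :: "'a \<Rightarrow> 'a \<Rightarrow> real"
  assumes "\<And>x y. e x y \<le> b"
  shows "walk_weight e (x # xs) \<le> b * length xs"
proof (induction xs arbitrary: x)
  case (Cons y ys)
  show ?case using Cons[of y] assms[of x y] by (simp add: algebra_simps)
qed simp

lemma walk_weight_eq_0:
  "successively (\<lambda>x y. e x y = 0) xs \<Longrightarrow> walk_weight e xs = 0"
  by (induction e xs rule: walk_weight.induct) auto

lemma walk_weight_conv_sum:
  "walk_weight w xs = (\<Sum>i<length xs - 1. w (xs ! i) (xs ! Suc i))"
proof (induction w xs rule: walk_weight.induct)
  case (1 w x y zs)
  then show ?case by (simp add: sum.lessThan_Suc_shift del: sum.lessThan_Suc)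
qed auto

lemma walk_weight_le_potential_diff:
  fixes p :: "'a \<Rightarrow> real"
  assumes "successively (\<lambda>x y. p x + w x y \<le> p y) xs" "xs \<noteq> []"
  shows "p (hd xs) + walk_weight w xs \<le> p (last xs)"
  using assms by (induction w xs rule: walk_weight.induct) auto

text \<open>The potential at \<open>x\<close> is the maximal weight of a simple path ending at
  \<open>x\<close>. Appending a step either gives a simple path again or closes a simple cycle,
  whose removal cannot lower the weight. Only simple cycles are constrained, which later bounds the
  number of steps by \<open>card X\<close>.\<close>

lemma potential_exists:
  fixes w :: "'a \<Rightarrow> 'a \<Rightarrow> real"
  assumes fin: "finite X"
    and cyc: "\<And>x xs. distinct (x # xs) \<Longrightarrow> set (x # xs) \<subseteq> X \<Longrightarrow> successively E (x # xs @ [x])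
                \<Longrightarrow> walk_weight w (x # xs @ [x]) \<le> 0"
  shows "\<exists>p. \<forall>x\<in>X. \<forall>y\<in>X. E x y \<longrightarrow> p x + w x y \<le> p y"
proof -
  define paths where
    "paths x = {xs. distinct (xs @ [x]) \<and> set xs \<subseteq> X \<and> successively E (xs @ [x])}" for x
  define p where "p x = Max ((\<lambda>xs. walk_weight w (xs @ [x])) ` paths x)" for x
  have fin_paths: "finite (paths x)" for x
    by (rule finite_subset[OF _ finite_subset_distinct[OF fin]]) (auto simp: paths_def)
  \<comment> \<open>The one-vertex path makes the set of weights nonempty, so that
    \<open>Max\<close> is attained.\<close>
  have "[] \<in> paths x" for x
    by (auto simp: paths_def)
  then have p_attained: "\<exists>xs\<in>paths x. p x = walk_weight w (xs @ [x])" for x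
    using Max_in[of "(\<lambda>xs. walk_weight w (xs @ [x])) ` paths x"] fin_paths[of x]
    unfolding p_def by blast
  have p_upper: "walk_weight w (xs @ [x]) \<le> p x" if "xs \<in> paths x" for x xs
    unfolding p_def by (rule Max_ge) (use that fin_paths in auto)
  have "p x + w x y \<le> p y" if xy: "x \<in> X" "y \<in> X" "E x y" for x y
  proof -
    obtain xs where xs: "xs \<in> paths x" "p x = walk_weight w (xs @ [x])"
      using p_attained by blast
    have weight: "walk_weight w ((xs @ [x]) @ [y]) = p x + w x y"
      using walk_weight_append[of w xs x "[y]"] xs(2) by simp
    have walk: "successively E ((xs @ [x]) @ [y])"
      using xs(1) xy(3) by (auto simp: paths_def successively_append_iff)
    show ?thesis
    proof (cases "y \<in> set (xs @ [x])")
      case False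
      then have "xs @ [x] \<in> paths y"
        using xs(1) xy walk by (auto simp: paths_def)
      then show ?thesis using p_upper weight by fastforce
    next
      case True
      \<comment> \<open>The extended path runs along \<open>us\<close> to \<open>y\<close> and then
        around the simple cycle \<open>y # vs @ [y]\<close>; the part up to \<open>y\<close> is
        itself a candidate for \<open>p y\<close>.\<close>
      then obtain us vs where uv: "xs @ [x] = us @ y # vs"
        by (meson split_list)
      have dist: "distinct (us @ y # vs)" and sub: "set (us @ y # vs) \<subseteq> X"
        unfolding uv[symmetric] using xs(1) xy by (auto simp: paths_def)
      have "successively E (us @ y # vs @ [y])"
        using walk unfolding uv by simp
      then have "successively E (us @ [y])" "successively E (y # vs @ [y])"
        by (auto simp: successively_append_iff)
      moreover from this have "us \<in> paths y"
        using dist sub by (auto simp: paths_def)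
      moreover have "walk_weight w (y # vs @ [y]) \<le> 0"
        by (rule cyc) (use dist sub calculation in auto)
      moreover have "p x + w x y = walk_weight w (us @ [y]) + walk_weight w (y # vs @ [y])"
        using weight walk_weight_append[of w us y "vs @ [y]"] unfolding uv by simp
      ultimately show ?thesis using p_upper[of us y] by linarith
    qed
  qed
  then show ?thesis by blast
qed

section \<open>Closed walks as lists, and components of value zero\<close>

definition forcing_step :: "('a \<Rightarrow> 'a \<Rightarrow> bool) \<Rightarrow> 'a \<Rightarrow> 'a \<Rightarrow> bool" where
  "forcing_step r x y \<longleftrightarrow> r x y \<or> incomparable r x y"

text \<open>The value \<open>-1\<close> is a default for all pairs outside \<open>r\<close>; on a
  forcing step it means incomparability.\<close>

definition step_weight :: "('a \<Rightarrow> 'a \<Rightarrow> bool) \<Rightarrow> 'a \<Rightarrow> 'a \<Rightarrow> int" where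
  "step_weight r x y = (if r x y then 1 else -1)"

text \<open>The list repeats its first vertex at the end, so length at least 2 corresponds to
  \<open>t \<ge> 1\<close>.\<close>

definition closed_walk :: "'a set \<Rightarrow> ('a \<Rightarrow> 'a \<Rightarrow> bool) \<Rightarrow> 'a list \<Rightarrow> bool" where
  "closed_walk X r xs \<longleftrightarrow>
     2 \<le> length xs \<and> hd xs = last xs \<and> set xs \<subseteq> X \<and> successively (forcing_step r) xs"

definition zero_walk :: "'a set \<Rightarrow> ('a \<Rightarrow> 'a \<Rightarrow> bool) \<Rightarrow> 'a list \<Rightarrow> bool" where
  "zero_walk X r xs \<longleftrightarrow> closed_walk X r xs \<and> walk_weight (step_weight r) xs = 0"

definition tight_step :: "'a set \<Rightarrow> ('a \<Rightarrow> 'a \<Rightarrow> bool) \<Rightarrow> 'a \<Rightarrow> 'a \<Rightarrow> bool" where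
  "tight_step X r x y \<longleftrightarrow> (\<exists>us vs. zero_walk X r (us @ x # y # vs))"

text \<open>One representation will be chosen per such set. It is empty if no zero walk passes
  through \<open>x\<close>.\<close>

definition zero_component :: "'a set \<Rightarrow> ('a \<Rightarrow> 'a \<Rightarrow> bool) \<Rightarrow> 'a \<Rightarrow> 'a set" where
  "zero_component X r x = \<Union> (set ` {xs. zero_walk X r xs \<and> x \<in> set xs})"

text \<open>Transfers hypotheses about forcing cycles, which are functions on \<open>nat\<close>, to
  lists; a list of length \<open>n\<close> has \<open>n - 1\<close> steps.\<close>

lemma closed_walk_forcing_cycle:
  assumes "closed_walk X r xs"
  shows "forcing_cycle X r (nth xs) (length xs - 1)"
    and "cycle_val r (nth xs) (length xs - 1) = walk_weight (step_weight r) xs"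
    and "nth xs ` {..length xs - 1} = set xs"
proof -
  let ?t = "length xs - 1"
  have len: "2 \<le> length xs" and ne: "xs \<noteq> []" and ends: "hd xs = last xs" and sub: "set xs \<subseteq> X"
    using assms by (auto simp: closed_walk_def)
  have step: "forcing_step r (xs ! i) (xs ! Suc i)" if "i < ?t" for i
    using assms that by (auto simp: closed_walk_def successively_conv_nth)
  show "forcing_cycle X r (nth xs) ?t"
    using len ends sub ne step
    by (auto simp: forcing_cycle_def hd_conv_nth last_conv_nth forcing_step_def subset_iff)
  have "{..?t} = {..<length xs}"
    using len by auto
  then show "nth xs ` {..?t} = set xs"
    by (auto simp: set_conv_nth)
  let ?A = "{i. i < ?t \<and> r (xs ! i) (xs ! Suc i)}"
  let ?B = "{i. i < ?t \<and> incomparable r (xs ! i) (xs ! Suc i)}"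
  let ?w = "\<lambda>i. step_weight r (xs ! i) (xs ! Suc i)"
  have "{..<?t} = ?A \<union> ?B" "?A \<inter> ?B = {}"
    using step by (auto simp: forcing_step_def incomparable_def)
  then have "sum ?w {..<?t} = sum ?w ?A + sum ?w ?B"
    by (simp add: sum.union_disjoint)
  also have "sum ?w ?A = int (card ?A)"
    by (simp add: step_weight_def)
  also have "sum ?w ?B = - int (card ?B)"
    by (simp add: step_weight_def incomparable_def)
  finally show "cycle_val r (nth xs) ?t = walk_weight (step_weight r) xs"
    by (simp add: cycle_val_def walk_weight_conv_sum)
qed

text \<open>Cut at \<open>v\<close> and swap the two pieces: the old base point \<open>a\<close>
  then occurs once at the seam instead of at both ends, and the steps are only permuted
  cyclically.\<close>

lemma zero_walk_rotate:
  assumes "zero_walk X r xs" "v \<in> set xs"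
  shows "\<exists>ys. ys \<noteq> [] \<and> zero_walk X r (v # ys) \<and> last ys = v \<and> set (v # ys) = set xs"
proof -
  obtain us vs where xs: "xs = us @ v # vs"
    using assms(2) by (meson split_list)
  show ?thesis
  proof (cases us)
    case Nil
    then show ?thesis using assms(1) xs
      by (intro exI[of _ vs]) (auto simp: zero_walk_def closed_walk_def split: if_splits)
  next
    case (Cons a us')
    have last: "last (v # vs) = a"
      using assms(1) unfolding xs Cons by (auto simp: zero_walk_def closed_walk_def)
    then obtain zs where zs: "v # vs = zs @ [a]"
      by (metis append_butlast_last_id list.distinct(1))
    have "walk_weight (step_weight r) (zs @ a # us' @ [v]) = walk_weight (step_weight r) xs"
      using walk_weight_append[of "step_weight r" zs a "us' @ [v]"]
        walk_weight_append[of "step_weight r" us v vs] zs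
      by (simp add: xs Cons)
    moreover have "successively (forcing_step r) ((a # us') @ v # vs)"
      using assms(1) unfolding xs Cons zero_walk_def closed_walk_def by blast
    then have "successively (forcing_step r) ((a # us') @ [v])"
      "successively (forcing_step r) (zs @ [a])"
      using successively_append_iff[of "forcing_step r" "(a # us') @ [v]" vs]
        successively_append_iff[of "forcing_step r" "a # us'" "v # vs"] zs by simp_all
    then have "successively (forcing_step r) (zs @ a # us' @ [v])"
      by (auto simp: successively_append_iff)
    moreover have eq: "zs @ a # us' @ [v] = v # vs @ us' @ [v]"
      using zs by (metis append.assoc append_Cons append_Nil)
    moreover have "a \<in> set (v # vs)"
      using zs by simp
    ultimately show ?thesis using assms(1)
      by (intro exI[of _ "vs @ us' @ [v]"])
        (auto simp: zero_walk_def closed_walk_def xs Cons)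
  qed
qed

text \<open>Both walks are rotated to begin and end at the common vertex \<open>v\<close>; their
  concatenation has value \<open>0 + 0\<close>.\<close>

lemma zero_walk_join:
  assumes "zero_walk X r xs" "zero_walk X r ys" "v \<in> set xs" "v \<in> set ys"
  shows "\<exists>zs. zero_walk X r zs \<and> set zs = set xs \<union> set ys"
proof -
  obtain as where as: "as \<noteq> []" "zero_walk X r (v # as)" "last as = v" "set (v # as) = set xs"
    using zero_walk_rotate assms by metis
  obtain bs where bs: "bs \<noteq> []" "zero_walk X r (v # bs)" "last bs = v" "set (v # bs) = set ys"
    using zero_walk_rotate assms by metis
  obtain cs where cs: "as = cs @ [v]"
    using as(1,3) by (metis append_butlast_last_id)
  have "walk_weight (step_weight r) (v # as @ bs) = 0"
    using as(2) bs(2) walk_weight_append[of "step_weight r" "v # cs" v bs]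
    by (simp add: zero_walk_def cs)
  then have "zero_walk X r (v # as @ bs)"
    using as bs by (auto simp: zero_walk_def closed_walk_def successively_append_iff
        successively_Cons)
  moreover have "set (v # as @ bs) = set xs \<union> set ys"
    using as(4) bs(4) by auto
  ultimately show ?thesis by blast
qed

text \<open>A zero walk through \<open>x\<close> can be joined with \<open>xs\<close> at
  \<open>x\<close>, and the result passes through \<open>y\<close> too.\<close>

lemma zero_component_eq:
  assumes "zero_walk X r xs" "x \<in> set xs" "y \<in> set xs"
  shows "zero_component X r x = zero_component X r y"
proof -
  have "zero_component X r x \<subseteq> zero_component X r y" if x: "x \<in> set xs" and y: "y \<in> set xs" for x y
  proof
    fix z assume "z \<in> zero_component X r x"
    then obtain ys where "zero_walk X r ys" "x \<in> set ys" "z \<in> set ys"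
      by (auto simp: zero_component_def)
    with zero_walk_join[OF assms(1) this(1) x this(2)] y show "z \<in> zero_component X r y"
      unfolding zero_component_def by blast
  qed
  then show ?thesis using assms by blast
qed

text \<open>Take a zero walk through \<open>x\<close> with the most vertices: joining it with any
  other zero walk through \<open>x\<close> cannot enlarge it, so it already covers the
  union.\<close>

lemma zero_component_zero_walk:
  assumes "finite X" "zero_walk X r xs" "x \<in> set xs"
  shows "\<exists>ys. zero_walk X r ys \<and> set ys = zero_component X r x"
proof -
  let ?P = "\<lambda>ys. zero_walk X r ys \<and> x \<in> set ys"
  have sub: "set ys \<subseteq> X" if "?P ys" for ys
    using that by (auto simp: zero_walk_def closed_walk_def)
  have "\<exists>ys. ?P ys \<and> (\<forall>zs. ?P zs \<longrightarrow> card (set zs) \<le> card (set ys))"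
    by (rule ex_has_greatest_nat[where k = xs and b = "Suc (card X)"])
      (use assms sub in \<open>auto simp: less_Suc_eq_le intro!: card_mono\<close>)
  then obtain ys where ys: "?P ys" "\<And>zs. ?P zs \<Longrightarrow> card (set zs) \<le> card (set ys)"
    by blast
  have "set zs \<subseteq> set ys" if zs: "?P zs" for zs
  proof -
    obtain us where us: "zero_walk X r us" "set us = set ys \<union> set zs"
      using zero_walk_join ys(1) zs by metis
    then have "card (set us) \<le> card (set ys)"
      using ys by blast
    then have "set ys = set us"
      using us(2) by (intro card_seteq) auto
    then show ?thesis using us(2) by auto
  qed
  then have "set ys = zero_component X r x"
    using ys(1) by (auto simp: zero_component_def)
  then show ?thesis using ys(1) by blast
qed

section \<open>What a representation says about forcing steps\<close>

text \<open>With half-length \<open>h\<close>, \<open>r x y\<close> forces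
  \<open>R(x) \<le> c(y)\<close>, and failure of \<open>r y x\<close> forces
  \<open>R(y) \<ge> c(x)\<close>. Dividing by \<open>h\<close> normalises the half-length to
  1.\<close>

lemma S_representation_step:
  assumes rep: "S_representation S Y r I"
    and len: "h > 0" "\<And>x. x \<in> Y \<Longrightarrow> right_end (I x) - left_end (I x) = 2 * h"
    and xy: "x \<in> Y" "y \<in> Y" "forcing_step r x y"
  shows "center (I x) / h + step_weight r x y \<le> center (I y) / h"
proof -
  have R: "right_end (I z) = center (I z) + h" if "z \<in> Y" for z
    using len(2)[OF that] by (simp add: center_def field_simps)
  have prec: "r a b \<longleftrightarrow> interval_precedes (I a) (I b)" if "a \<in> Y" "b \<in> Y" for a b
    using rep that by (auto simp: S_representation_def)
  show ?thesis
  proof (cases "r x y")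
    case True
    then have "center (I x) + h \<le> center (I y)"
      using prec[OF xy(1,2)] R[OF xy(1)] by (auto simp: interval_precedes_def)
    then have "(center (I x) + h) / h \<le> center (I y) / h"
      using len(1) by (intro divide_right_mono) auto
    then show ?thesis using True len(1) by (simp add: step_weight_def add_divide_distrib)
  next
    case False
    then have "\<not> r y x"
      using xy(3) by (auto simp: forcing_step_def incomparable_def)
    then have "center (I x) \<le> center (I y) + h"
      using prec[OF xy(2,1)] R[OF xy(2)] by (auto simp: interval_precedes_def)
    then have "center (I x) / h \<le> (center (I y) + h) / h"
      using len(1) by (intro divide_right_mono) auto
    then show ?thesis using False len(1) by (simp add: step_weight_def add_divide_distrib)
  qed
qed

text \<open>Around a closed walk of weight zero the step inequalities add up to
  \<open>0 \<le> 0\<close>, so each is an equality. Then an endpoint meets a center, and the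
  openness condition alone decides the relation.\<close>

lemma tight_step_types:
  assumes rep: "S_representation S Y r I"
    and zero: "zero_walk X r (us @ x # y # vs)"
    and sub: "set (us @ x # y # vs) \<subseteq> Y"
  shows "if r x y
         then (endpoints_open (itype (I x)) \<or> center_open (itype (I y))) \<and>
              (endpoints_open (itype (I y)) \<or> center_open (itype (I x)))
         else \<not> ((endpoints_open (itype (I x)) \<or> center_open (itype (I y))) \<and>
                 (endpoints_open (itype (I y)) \<or> center_open (itype (I x))))"
proof -
  obtain l where l: "l > 0" "\<And>x. x \<in> Y \<Longrightarrow> right_end (I x) - left_end (I x) = l"
    using rep by (auto simp: S_representation_def)
  define h where "h = l / 2"
  have h: "h > 0" "\<And>x. x \<in> Y \<Longrightarrow> right_end (I x) - left_end (I x) = 2 * h"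
    using l by (auto simp: h_def)
  define p where "p z = center (I z) / h" for z
  define w where "w a b = real_of_int (step_weight r a b)" for a b
  let ?xs = "us @ x # y # vs"
  have walk: "successively (forcing_step r) ?xs" and ends: "hd ?xs = last ?xs"
    and val: "walk_weight w ?xs = 0"
    using zero unfolding zero_walk_def closed_walk_def w_def walk_weight_of_int by simp_all
  have "successively (\<lambda>a b. p a + w a b \<le> p b) ?xs"
    by (rule successively_mono[OF walk])
      (use S_representation_step[OF rep h] sub in \<open>auto simp: p_def w_def\<close>)
  \<comment> \<open>The walk is cut around the step from \<open>x\<close> to \<open>y\<close>, so
    that the slack of this single step can be isolated.\<close>
  then have "successively (\<lambda>a b. p a + w a b \<le> p b) (us @ [x])"
    and "successively (\<lambda>a b. p a + w a b \<le> p b) (y # vs)" and le: "p x + w x y \<le> p y"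
    by (auto simp: successively_append_iff)
  then have "p (hd (us @ [x])) + walk_weight w (us @ [x]) \<le> p x"
    and "p y + walk_weight w (y # vs) \<le> p (last (y # vs))"
    using walk_weight_le_potential_diff[of p w "us @ [x]"]
      walk_weight_le_potential_diff[of p w "y # vs"] by auto
  moreover have "walk_weight w ?xs = walk_weight w (us @ [x]) + w x y + walk_weight w (y # vs)"
    using walk_weight_append[of w us x "y # vs"] by simp
  moreover have "hd (us @ [x]) = last (y # vs)"
    using ends by (cases us) auto
  ultimately have "p y = p x + w x y"
    using le val by simp
  then have cy: "center (I y) = center (I x) + h * step_weight r x y"
    using h(1) by (simp add: p_def w_def field_simps)
  have xy: "x \<in> Y" "y \<in> Y" and step: "forcing_step r x y"
    using sub walk by (auto simp: successively_append_iff)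
  have R: "right_end (I z) = center (I z) + h" if "z \<in> Y" for z
    using h(2)[OF that] by (simp add: center_def field_simps)
  have prec: "r a b \<longleftrightarrow> interval_precedes (I a) (I b)" if "a \<in> Y" "b \<in> Y" for a b
    using rep that by (auto simp: S_representation_def)
  show ?thesis
  proof (cases "r x y")
    case True
    then have "right_end (I x) = center (I y)"
      using cy R[OF xy(1)] by (simp add: step_weight_def)
    then show ?thesis using True prec[OF xy] by (simp add: interval_precedes_def)
  next
    case False
    then have "\<not> r y x"
      using step by (auto simp: forcing_step_def incomparable_def)
    moreover have "right_end (I y) = center (I x)"
      using False cy R[OF xy(2)] by (simp add: step_weight_def)
    \<comment> \<open>Exchanging \<open>x\<close> and \<open>y\<close> only swaps the two conjuncts
      of the openness condition, so the failure for the pair \<open>y\<close>, \<open>x\<close> is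
      the desired one.\<close>
    ultimately have "\<not> ((endpoints_open (itype (I y)) \<or> center_open (itype (I x))) \<and>
        (endpoints_open (itype (I x)) \<or> center_open (itype (I y))))"
      using prec[OF xy(2,1)] by (simp add: interval_precedes_def)
    then show ?thesis using False by argo
  qed
qed

section \<open>Choice of centers and types\<close>

text \<open>Non-tight steps get the extra weight \<open>\<epsilon>\<close>, which makes their
  inequalities strict in the resulting potential. No simple cycle becomes positive: those of value
  zero contain only tight steps, and the others have value at most \<open>-1\<close>.\<close>

lemma centers_exist:
  assumes fin: "finite X"
    and nonpos: "\<And>xs. closed_walk X r xs \<Longrightarrow> walk_weight (step_weight r) xs \<le> 0"
  shows "\<exists>c :: 'a \<Rightarrow> real. \<forall>x\<in>X. \<forall>y\<in>X. forcing_step r x y \<longrightarrow>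
           c x + step_weight r x y \<le> c y \<and>
           (tight_step X r x y \<or> c x + step_weight r x y < c y)"
proof -
  \<comment> \<open>A simple cycle has at most \<open>card X\<close> steps, so the total increase
    stays at most 1, the gap between zero and the negative integers.\<close>
  define \<epsilon> where "\<epsilon> = 1 / (real (card X) + 1)"
  have \<epsilon>: "\<epsilon> > 0" "\<epsilon> * card X \<le> 1"
    by (auto simp: \<epsilon>_def field_simps)
  define e where "e x y = (if tight_step X r x y then 0 else \<epsilon>)" for x y
  have "walk_weight (\<lambda>x y. real_of_int (step_weight r x y) + e x y) (x # xs @ [x]) \<le> 0"
    if dist: "distinct (x # xs)" and sub: "set (x # xs) \<subseteq> X"
      and walk: "successively (forcing_step r) (x # xs @ [x])" for x xs
  proof -
    let ?xs = "x # xs @ [x]"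
    have closed: "closed_walk X r ?xs"
      using sub walk by (auto simp: closed_walk_def)
    have split: "walk_weight (\<lambda>x y. real_of_int (step_weight r x y) + e x y) ?xs
        = real_of_int (walk_weight (step_weight r) ?xs) + walk_weight e ?xs"
      unfolding walk_weight_add walk_weight_of_int ..
    show ?thesis
    proof (cases "walk_weight (step_weight r) ?xs = 0")
      case True
      then have zero: "zero_walk X r ?xs"
        using closed by (simp add: zero_walk_def)
      have "e (?xs ! i) (?xs ! Suc i) = 0" if "Suc i < length ?xs" for i
      proof -
        have "?xs = take i ?xs @ ?xs ! i # ?xs ! Suc i # drop (Suc (Suc i)) ?xs"
          using that by (metis Cons_nth_drop_Suc Suc_lessD append_take_drop_id)
        then have "tight_step X r (?xs ! i) (?xs ! Suc i)"
          using zero unfolding tight_step_def by metis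
        then show ?thesis by (simp add: e_def)
      qed
      then have "walk_weight e ?xs = 0"
        by (intro walk_weight_eq_0) (simp add: successively_conv_nth)
      then show ?thesis using True split by simp
    next
      case False
      then have "walk_weight (step_weight r) ?xs \<le> -1"
        using nonpos[OF closed] by linarith
      moreover have "walk_weight e ?xs \<le> \<epsilon> * length (xs @ [x])"
        by (rule walk_weight_le) (use \<epsilon> in \<open>auto simp: e_def\<close>)
      moreover have "length (xs @ [x]) \<le> card X"
        using card_mono[OF fin sub] distinct_card[OF dist] by simp
      then have "\<epsilon> * length (xs @ [x]) \<le> \<epsilon> * card X"
        using \<epsilon>(1) by (intro mult_left_mono) auto
      ultimately show ?thesis using split \<epsilon>(2) by linarith
    qed
  qed
  from potential_exists[of X "forcing_step r", OF fin this]
  obtain c :: "'a \<Rightarrow> real" where c: "\<forall>x\<in>X. \<forall>y\<in>X. forcing_step r x y \<longrightarrow>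
      c x + (step_weight r x y + e x y) \<le> c y"
    by blast
  show ?thesis
  proof (intro exI[of _ c] ballI impI)
    fix x y assume "x \<in> X" "y \<in> X" "forcing_step r x y"
    then have "c x + (step_weight r x y + e x y) \<le> c y"
      using c by blast
    then show "c x + step_weight r x y \<le> c y \<and>
           (tight_step X r x y \<or> c x + step_weight r x y < c y)"
      using \<epsilon>(1) by (auto simp: e_def split: if_splits)
  qed
qed

text \<open>Both ends of a tight step lie in one zero component, so their types come from one
  representation of that component, where the step also holds with equality.\<close>

lemma types_exist:
  assumes "S \<noteq> {}" "finite X"
    and reps: "\<And>xs. zero_walk X r xs \<Longrightarrow> \<exists>I. S_representation S (set xs) r I"
  shows "\<exists>\<tau>. (\<forall>x. \<tau> x \<in> S) \<and>
    (\<forall>x y. tight_step X r x y \<longrightarrow>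
       (r x y \<longleftrightarrow> (endpoints_open (\<tau> x) \<or> center_open (\<tau> y)) \<and>
                  (endpoints_open (\<tau> y) \<or> center_open (\<tau> x))))"
proof -
  obtain s where s: "s \<in> S"
    using assms(1) by blast
  \<comment> \<open>The choice depends on the set \<open>K\<close> alone, so all vertices of a
    component share one representation.\<close>
  define J where "J K = (SOME I. S_representation S K r I)" for K
  define on_zero where "on_zero x \<longleftrightarrow> (\<exists>xs. zero_walk X r xs \<and> x \<in> set xs)" for x
  \<comment> \<open>Vertices on no zero walk are on no tight step, so any type \<open>s\<close> in
    \<open>S\<close> will do.\<close>
  define \<tau> where "\<tau> x = (if on_zero x then itype (J (zero_component X r x) x) else s)" for x
  have rep: "S_representation S (zero_component X r x) r (J (zero_component X r x))" if x: "on_zero x" for x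
  proof -
    obtain ys where "zero_walk X r ys" "set ys = zero_component X r x"
      using x zero_component_zero_walk[OF assms(2)] unfolding on_zero_def by blast
    then have "\<exists>I. S_representation S (zero_component X r x) r I"
      using reps by metis
    then show ?thesis unfolding J_def by (rule someI_ex)
  qed
  have mem: "x \<in> zero_component X r x" if "on_zero x" for x
    using that by (auto simp: on_zero_def zero_component_def)
  have "\<tau> x \<in> S" for x
    using rep[of x] mem[of x] s by (auto simp: \<tau>_def S_representation_def)
  moreover have "r x y \<longleftrightarrow> (endpoints_open (\<tau> x) \<or> center_open (\<tau> y)) \<and>
                  (endpoints_open (\<tau> y) \<or> center_open (\<tau> x))" if tight: "tight_step X r x y" for x y
  proof -
    obtain us vs where zero: "zero_walk X r (us @ x # y # vs)"
      using tight by (auto simp: tight_step_def)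
    have on: "on_zero x" "on_zero y"
      using zero by (force simp: on_zero_def)+
    have eq: "zero_component X r y = zero_component X r x"
      by (rule zero_component_eq[OF zero]) auto
    have "set (us @ x # y # vs) \<subseteq> zero_component X r x"
      using zero unfolding zero_component_def by force
    from tight_step_types[OF rep[OF on(1)] zero this] show ?thesis
      using on by (auto simp: \<tau>_def eq split: if_splits)
  qed
  ultimately show ?thesis by blast
qed

section \<open>Assembling the representation\<close>

theorem theorem9:
  fixes S :: "interval_type set"
    and X :: "'a set"
    and r :: "'a \<Rightarrow> 'a \<Rightarrow> bool"
  assumes "S \<noteq> {}"
    and "finite X"
    and "strict_poset X r"
    and "\<And>x t. forcing_cycle X r x t \<Longrightarrow> cycle_val r x t \<le> 0"
    and "\<And>x t. forcing_cycle X r x t \<Longrightarrow> cycle_val r x t = 0 \<Longrightarrow> S_order S (x ` {..t}) r"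
  shows "S_order S X r"
proof -
  have "walk_weight (step_weight r) xs \<le> 0" if "closed_walk X r xs" for xs
    using assms(4)[OF closed_walk_forcing_cycle(1)[OF that]] closed_walk_forcing_cycle(2)[OF that]
    by simp
  from centers_exist[OF assms(2) this] obtain c :: "'a \<Rightarrow> real" where
    c: "\<And>x y. x \<in> X \<Longrightarrow> y \<in> X \<Longrightarrow> forcing_step r x y \<Longrightarrow> c x + step_weight r x y \<le> c y \<and>
           (tight_step X r x y \<or> c x + step_weight r x y < c y)"
    by blast
  have "\<exists>I. S_representation S (set xs) r I" if "zero_walk X r xs" for xs
  proof -
    have closed: "closed_walk X r xs" and "walk_weight (step_weight r) xs = 0"
      using that by (auto simp: zero_walk_def)
    then have "S_order S (nth xs ` {..length xs - 1}) r"
      using closed_walk_forcing_cycle(1,2)[OF closed] by (intro assms(5)) auto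
    then show ?thesis
      unfolding closed_walk_forcing_cycle(3)[OF closed] by (auto simp: S_order_def)
  qed
  from types_exist[OF assms(1,2) this] obtain \<tau> where
    \<tau>: "\<And>x. \<tau> x \<in> S"
       "\<And>x y. tight_step X r x y \<Longrightarrow>
         r x y \<longleftrightarrow> (endpoints_open (\<tau> x) \<or> center_open (\<tau> y)) \<and>
                  (endpoints_open (\<tau> y) \<or> center_open (\<tau> x))"
    by blast
  \<comment> \<open>Half-length 1 matches the step weights \<open>1\<close> and
    \<open>-1\<close>.\<close>
  define I where "I x = Interval (c x - 1) (c x + 1) (\<tau> x)" for x
  have precedes: "interval_precedes (I x) (I y) \<longleftrightarrow> c x + 1 < c y \<or> c x + 1 = c y \<and>
      (endpoints_open (\<tau> x) \<or> center_open (\<tau> y)) \<and>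
      (endpoints_open (\<tau> y) \<or> center_open (\<tau> x))" for x y
    by (simp add: I_def interval_precedes_def center_def)
  have irrefl: "\<not> r x x" if "x \<in> X" for x
    using assms(3) that by (auto simp: strict_poset_def irreflp_on_def)
  have "r x y \<longleftrightarrow> interval_precedes (I x) (I y)" if xy: "x \<in> X" "y \<in> X" for x y
  proof -
    \<comment> \<open>Incomparability is read as a step from \<open>y\<close> to \<open>x\<close>:
      this gives \<open>c y \<le> c x + 1\<close>, with equality only for a tight step, where
      \<open>\<tau>\<close> excludes precedence.\<close>
    consider "r x y" | "x = y" | "r y x" "\<not> r x y" | "incomparable r y x"
      by (auto simp: incomparable_def)
    then show ?thesis
    proof cases
      case 1
      then show ?thesis using c[OF xy] \<tau>(2)[of x y]
        by (auto simp: precedes forcing_step_def step_weight_def)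
    next
      case 2
      then show ?thesis using irrefl xy by (simp add: precedes)
    next
      case 3
      then show ?thesis using c[OF xy(2,1)]
        by (auto simp: precedes forcing_step_def step_weight_def)
    next
      case 4
      then have "\<not> r x y" "\<not> r y x" by (auto simp: incomparable_def)
      then show ?thesis using 4 c[OF xy(2,1)] \<tau>(2)[of y x]
        by (auto simp: precedes forcing_step_def step_weight_def)
    qed
  qed
  then have "S_representation S X r I"
    using \<tau>(1) by (auto simp: S_representation_def I_def intro!: exI[of _ 2])
  then show ?thesis using assms(3) by (auto simp: S_order_def)
qed

end
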